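(* Let $\mathbb{F}$ be a field, let $d\ge 1$ and $0\le k\le d-1$ be integers, and let $\mathcal{H}$ be a set of projective $k$-subspaces of $\mathrm{PG}(d,\mathbb{F})$. If there is no projective subspace of co-dimension $k+1$ in $\mathrm{PG}(d,\mathbb{F})$ that meets (has nonempty intersection with) every element of $\mathcal{H}$, then $\mathcal{H}$ is a generator set with respect to co-$k$-subspaces.
   Context: $\mathrm{PG}(d,\mathbb{F})$ is the projective space whose points are the $1$-dimensional linear subspaces of $\mathbb{F}^{d+1}$; a projective $j$-subspace is the set of points contained in a linear subspace of rank $j+1$, and a projective subspace has co-dimension $c$ if its projective dimension is $d-c$. A set $\mathcal{H}$ of projective $k$-subspaces is a generator set with respect to co-$k$-subspaces (equivalently, its elements are "in higgledy-piggledy arrangement") if for every projective subspace $\Pi$ of co-dimension $k$, the set of points of $\Pi$ lying in at least one element of $\mathcal{H}$ spans $\Pi$ (i.e. is not contained in any hyperplane of $\Pi$). *)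

theory Defs
  imports "HOL-Analysis.Analysis"
begin

text \<open>
  \<open>PG(d, F)\<close> is modelled on the vector space \<open>'a ^ 'n\<close> over an arbitrary field \<open>'a\<close>,
  with \<open>CARD('n) = d + 1\<close>. Linear notions are those of the library interpretation \<open>vec\<close>
  (scalar multiplication \<open>*s\<close>), not the real ones. A point is a linear subspace of rank 1
  (a set of vectors), and a projective subspace is a set of points.
\<close>

definition pg_points :: "('a::field ^ 'n) set set" where
  "pg_points = {P. vec.subspace P \<and> vec.dim P = 1}"

definition points_in :: "('a::field ^ 'n) set \<Rightarrow> ('a ^ 'n) set set" where
  "points_in U = {P \<in> pg_points. P \<subseteq> U}"

text \<open>
  The projective dimension is an integer, so that the empty subspace, of dimension \<open>-1\<close>, is
  the hyperplane of a single point.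
\<close>

definition proj_subspace :: "int \<Rightarrow> ('a::field ^ 'n) set set \<Rightarrow> bool" where
  "proj_subspace j S \<longleftrightarrow>
     (\<exists>U. vec.subspace U \<and> int (vec.dim U) = j + 1 \<and> S = points_in U)"

definition pg_dimension :: "('a::field ^ 'n) itself \<Rightarrow> int" where
  "pg_dimension _ = int CARD('n) - 1"

definition proj_subspace_codim :: "nat \<Rightarrow> ('a::field ^ 'n) set set \<Rightarrow> bool" where
  "proj_subspace_codim c S \<longleftrightarrow> proj_subspace (pg_dimension TYPE('a ^ 'n) - int c) S"

definition proj_span :: "('a::field ^ 'n) set set \<Rightarrow> ('a ^ 'n) set set" where
  "proj_span X = points_in (vec.span (\<Union>X))"

definition generator_set :: "nat \<Rightarrow> ('a::field ^ 'n) set set set \<Rightarrow> bool" where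
  "generator_set k H \<longleftrightarrow>
     (\<forall>S\<in>H. proj_subspace (int k) S) \<and>
     (\<forall>S. proj_subspace_codim k S \<longrightarrow> proj_span (S \<inter> \<Union>H) = S)"

definition proj_hyperplane_of :: "('a::field ^ 'n) set set \<Rightarrow> ('a ^ 'n) set set \<Rightarrow> bool" where
  "proj_hyperplane_of T S \<longleftrightarrow> T \<subseteq> S \<and> (\<exists>j. proj_subspace j S \<and> proj_subspace (j - 1) T)"

lemma line_in_pg_points:
  fixes x :: "'a::field ^ 'n"
  assumes "x \<noteq> 0"
  shows "vec.span {x} \<in> pg_points"
  using assms unfolding pg_points_def by simp

lemma Union_points_in:
  fixes U :: "('a::field ^ 'n) set"
  assumes "vec.subspace U"
  shows "vec.span (\<Union>(points_in U)) = U"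
proof
  show "vec.span (\<Union>(points_in U)) \<subseteq> U"
    using assms by (intro vec.span_minimal) (auto simp: points_in_def)
  show "U \<subseteq> vec.span (\<Union>(points_in U))"
  proof
    fix x assume x: "x \<in> U"
    show "x \<in> vec.span (\<Union>(points_in U))"
    proof (cases "x = 0")
      case True
      then show ?thesis by (simp add: vec.span_zero)
    next
      case False
      have "vec.span {x} \<subseteq> U" using x assms by (intro vec.span_minimal) auto
      then have "vec.span {x} \<in> points_in U"
        using line_in_pg_points[OF False] by (simp add: points_in_def)
      moreover have "x \<in> vec.span {x}" by (simp add: vec.span_base)
      ultimately show ?thesis by (meson UnionI vec.span_base)
    qed
  qed
qed

lemma points_in_subset_iff:
  fixes U V :: "('a::field ^ 'n) set"
  assumes "vec.subspace U" "vec.subspace V"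
  shows "points_in U \<subseteq> points_in V \<longleftrightarrow> U \<subseteq> V"
proof
  assume "points_in U \<subseteq> points_in V"
  then have "vec.span (\<Union>(points_in U)) \<subseteq> vec.span (\<Union>(points_in V))"
    by (intro vec.span_mono Union_mono)
  then show "U \<subseteq> V" using assms by (simp add: Union_points_in)
qed (auto simp: points_in_def)

text \<open>
  Spanning a projective subspace is the same as not being contained in any of its hyperplanes.
\<close>

lemma proj_span_eq_iff_no_hyperplane:
  fixes S X :: "('a::field ^ 'n) set set"
  assumes S: "proj_subspace j S" and X: "X \<subseteq> S"
  shows "proj_span X = S \<longleftrightarrow> \<not> (\<exists>T. proj_hyperplane_of T S \<and> X \<subseteq> T)"
proof -
  obtain U where U: "vec.subspace U" "int (vec.dim U) = j + 1" "S = points_in U"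
    using S by (auto simp: proj_subspace_def)
  let ?W = "vec.span (\<Union>X)"
  have WU: "?W \<subseteq> U"
    using X U by (intro vec.span_minimal) (auto simp: points_in_def)
  have eq: "proj_span X = S \<longleftrightarrow> ?W = U"
    unfolding proj_span_def U(3)
    by (metis U(1) Union_points_in vec.subspace_span)
  show ?thesis
  proof
    assume "proj_span X = S"
    then have W: "?W = U" using eq by simp
    show "\<not> (\<exists>T. proj_hyperplane_of T S \<and> X \<subseteq> T)"
    proof
      assume "\<exists>T. proj_hyperplane_of T S \<and> X \<subseteq> T"
      then obtain T i V U' where T: "X \<subseteq> T" "vec.subspace V" "int (vec.dim V) = i - 1 + 1"
          "T = points_in V" "vec.subspace U'" "int (vec.dim U') = i + 1" "S = points_in U'"
        unfolding proj_hyperplane_of_def proj_subspace_def by blast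
      have "U' = U" using T U by (metis Union_points_in)
      have "?W \<subseteq> V" using T by (intro vec.span_minimal) (auto simp: points_in_def)
      then have "vec.dim U \<le> vec.dim V" using W vec.dim_subset by metis
      then show False using T \<open>U' = U\<close> by simp
    qed
  next
    assume none: "\<not> (\<exists>T. proj_hyperplane_of T S \<and> X \<subseteq> T)"
    show "proj_span X = S"
    proof (rule ccontr)
      assume "proj_span X \<noteq> S"
      then have "?W \<noteq> U" using eq by simp
      obtain B where B: "B \<subseteq> ?W" "vec.independent B" "?W \<subseteq> vec.span B"
        by (rule vec.basis_exists)
      have "B \<subseteq> U" using B(1) WU by (rule order_trans)
      then obtain C where C: "B \<subseteq> C" "C \<subseteq> U" "vec.independent C" "U \<subseteq> vec.span C"
        using B(2) by (rule vec.maximal_independent_subset_extend)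
      have "B \<noteq> C"
      proof
        assume "B = C"
        then have "U \<subseteq> ?W" using C B vec.span_minimal[of B ?W] by simp
        then show False using WU \<open>?W \<noteq> U\<close> by simp
      qed
      then obtain c where c: "c \<in> C" "c \<notin> B" using C by blast
      let ?V = "vec.span (C - {c})"
      have finC: "finite C" using C(3) by (rule vec.finiteI_independent)
      have "vec.independent (C - {c})" using C(3) by (rule vec.independent_mono) auto
      then have dV: "vec.dim ?V = card C - 1"
        using c finC by (simp add: vec.dim_eq_card_independent)
      have "vec.span C = U" using C U(1) by (intro antisym vec.span_minimal)
      then have dU: "vec.dim U = card C"
        using C(3) vec.dim_span_eq_card_independent by metis
      have "card C > 0" using c finC card_gt_0_iff by blast
      then have "int (vec.dim ?V) = j - 1 + 1" using dV dU U(2) by simp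
      then have h1: "proj_subspace (j - 1) (points_in ?V)"
        unfolding proj_subspace_def using vec.subspace_span by blast
      have "?V \<subseteq> U" using C U(1) by (intro vec.span_minimal) auto
      then have h2: "points_in ?V \<subseteq> S" using U(3) by (auto simp: points_in_def)
      have "vec.span B \<subseteq> ?V" using C c by (intro vec.span_mono) auto
      then have WV: "?W \<subseteq> ?V" using B(3) by (rule order_trans[rotated])
      have "X \<subseteq> points_in ?V"
      proof
        fix P assume "P \<in> X"
        then have "P \<in> pg_points" "P \<subseteq> ?W"
          using X U(3) vec.span_superset[of "\<Union>X"] by (auto simp: points_in_def)
        then show "P \<in> points_in ?V" using WV by (auto simp: points_in_def)
      qed
      then show False using none h1 h2 S unfolding proj_hyperplane_of_def by blast
    qed
  qed
qed

end

theory Submission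
  imports Defs
begin

text \<open>The points of a linear subspace span it again, so \<open>S\<close> determines the linear
  subspace behind it and hence its rank. This covers the empty set of points too, which comes only
  from rank 0.\<close>

lemma proj_subspace_unique_dim:
  fixes S :: "('a::field ^ 'n) set set"
  assumes "proj_subspace i S" "proj_subspace j S"
  shows "i = j"
  using assms unfolding proj_subspace_def by (metis Union_points_in add_right_cancel)

text \<open>Grassmann's formula: the sum of \<open>U\<close> and \<open>V\<close> has rank at most
  \<open>CARD('n)\<close>, so the intersection has positive rank, and any nonzero vector in it spans
  a common point.\<close>

lemma points_in_Int_nonempty:
  fixes U V :: "('a::field ^ 'n) set"
  assumes U: "vec.subspace U" and V: "vec.subspace V"
    and dim: "CARD('n) < vec.dim U + vec.dim V"
  shows "points_in U \<inter> points_in V \<noteq> {}"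
proof -
  have "vec.dim {x + y |x y. x \<in> U \<and> y \<in> V} + vec.dim (U \<inter> V) = vec.dim U + vec.dim V"
    using U V by (rule vec.dim_sums_Int)
  moreover have "vec.dim {x + y |x y. x \<in> U \<and> y \<in> V} \<le> CARD('n)"
    using vec.dim_subset_UNIV[of "{x + y |x y. x \<in> U \<and> y \<in> V}"] by (simp add: vec.dimension_def card_cart_basis)
  ultimately have "vec.dim (U \<inter> V) > 0"
    using dim by linarith
  \<comment> \<open>\<open>vec.span {}\<close> is the zero subspace, and a set inside it would have
    rank at most \<open>card {} = 0\<close>.\<close>
  then have "\<not> U \<inter> V \<subseteq> vec.span {}"
    by (metis vec.dim_le_card finite.emptyI card.empty not_le)
  then obtain x where x: "x \<in> U \<inter> V" "x \<noteq> 0"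
    by auto
  then have "vec.span {x} \<subseteq> U" "vec.span {x} \<subseteq> V"
    using U V by (simp_all add: vec.span_minimal)
  then have "vec.span {x} \<in> points_in U \<inter> points_in V"
    using line_in_pg_points[OF x(2)] by (simp add: points_in_def)
  then show ?thesis by blast
qed

text \<open>The ranks \<open>CARD('n) - k\<close> and \<open>k + 1\<close> add up to one more than
  the rank of the whole space, just enough to force a common point.\<close>

lemma proj_subspace_meets_complementary:
  fixes S T :: "('a::field ^ 'n) set set"
  assumes S: "proj_subspace_codim k S" and T: "proj_subspace (int k) T"
  shows "S \<inter> T \<noteq> {}"
proof -
  obtain U where U: "vec.subspace U" "int (vec.dim U) = int CARD('n) - int k" "S = points_in U"
    using S by (auto simp: proj_subspace_codim_def proj_subspace_def pg_dimension_def)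
  obtain V where V: "vec.subspace V" "int (vec.dim V) = int k + 1" "T = points_in V"
    using T by (auto simp: proj_subspace_def)
  show ?thesis
    unfolding U(3) V(3) using U(1) V(1)
  proof (rule points_in_Int_nonempty)
    show "CARD('n) < vec.dim U + vec.dim V" using U(2) V(2) by linarith
  qed
qed

text \<open>
  If the points of a co-dimension \<open>k\<close> subspace \<open>S\<close> covered by \<open>H\<close> lay in a hyperplane \<open>T\<close> of
  \<open>S\<close>, then \<open>T\<close> would have co-dimension \<open>k + 1\<close> and meet every element of \<open>H\<close>, since each of
  them meets \<open>S\<close>.
\<close>

theorem mainTheorem1:
  fixes d k :: nat
    and H :: "('a::field ^ 'n) set set set"
  assumes "CARD('n) = d + 1"
    and "1 \<le> d"
    and "0 \<le> k" and "k \<le> d - 1"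
    and "\<forall>S\<in>H. proj_subspace (int k) S"
    and "\<not> (\<exists>T. proj_subspace_codim (k + 1) T \<and> (\<forall>S\<in>H. T \<inter> S \<noteq> {}))"
  shows "generator_set k H"
  unfolding generator_set_def
proof (intro conjI allI impI)
  show "\<forall>S\<in>H. proj_subspace (int k) S" by fact
next
  fix S :: "('a ^ 'n) set set"
  assume S: "proj_subspace_codim k S"
  let ?j = "pg_dimension TYPE('a ^ 'n) - int k"
  have Sj: "proj_subspace ?j S" using S by (simp add: proj_subspace_codim_def)
  have "\<not> (\<exists>T. proj_hyperplane_of T S \<and> S \<inter> \<Union>H \<subseteq> T)"
  proof
    assume "\<exists>T. proj_hyperplane_of T S \<and> S \<inter> \<Union>H \<subseteq> T"
    then obtain T i where T: "S \<inter> \<Union>H \<subseteq> T" "proj_subspace i S" "proj_subspace (i - 1) T"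
      by (auto simp: proj_hyperplane_of_def)
    \<comment> \<open>\<open>proj_hyperplane_of\<close> only provides some dimension
      \<open>i\<close> for \<open>S\<close>; the co-dimension of \<open>T\<close> is known once
      \<open>i\<close> is identified with \<open>?j\<close>.\<close>
    have "i = ?j" using T(2) Sj by (rule proj_subspace_unique_dim)
    then have "i - 1 = pg_dimension TYPE('a ^ 'n) - int (k + 1)" by simp
    with T(3) have "proj_subspace_codim (k + 1) T" by (simp only: proj_subspace_codim_def)
    moreover have "T \<inter> R \<noteq> {}" if "R \<in> H" for R
    proof -
      have "S \<inter> R \<noteq> {}"
        using S assms(5)[rule_format, OF that] by (rule proj_subspace_meets_complementary)
      \<comment> \<open>A point common to \<open>S\<close> and \<open>R\<close> is covered by
        \<open>H\<close>, so it already lies in \<open>T\<close>.\<close>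
      then show ?thesis using T(1) that by blast
    qed
    ultimately show False using assms(6) by blast
  qed
  then show "proj_span (S \<inter> \<Union>H) = S"
    using proj_span_eq_iff_no_hyperplane[OF Sj, of "S \<inter> \<Union>H"] by simp
qed

end
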